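(* Let $Q$ be a CC-loop and let $b,c\in Q$ be power-associative elements such that $c$ is a WIP element. Then the subloop $\langle b,c^2\rangle$ is a group.
   Context: A loop is a set $Q$ with a binary operation having a two-sided identity $1$ such that all equations $xu=y$ and $vx=y$ have unique solutions $u=x\backslash y$ and $v=y/x$. A loop $Q$ is conjugacy closed (a CC-loop) if there are functions $f,g:Q\times Q\to Q$ such that for all $x,y,z\in Q$: $x(yz)=f(x,y)(xz)$ and $(zy)x=(zx)g(x,y)$. $\langle S\rangle$ denotes the subloop generated by $S$. An element $a$ is power-associative if $\langle a\rangle$ is a group. An element $c$ is a WIP element if $c\cdot((xc)\backslash 1)=x\backslash 1$ for all $x\in Q$. *)

theory Defs
  imports "HOL-Algebra.Group"
begin

text \<open>
  Loops are carried by the \<open>monoid\<close> records of HOL-Algebra, used only for their fields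
  (carrier, multiplication, identity); associativity is not assumed.
\<close>

locale loop =
  fixes Q :: "('a, 'b) monoid_scheme" (structure)
  assumes mult_closed: "\<lbrakk>x \<in> carrier Q; y \<in> carrier Q\<rbrakk> \<Longrightarrow> x \<otimes> y \<in> carrier Q"
    and one_closed: "\<one> \<in> carrier Q"
    and mult_one_left: "x \<in> carrier Q \<Longrightarrow> \<one> \<otimes> x = x"
    and mult_one_right: "x \<in> carrier Q \<Longrightarrow> x \<otimes> \<one> = x"
    and left_division: "\<lbrakk>x \<in> carrier Q; y \<in> carrier Q\<rbrakk> \<Longrightarrow> \<exists>!u. u \<in> carrier Q \<and> x \<otimes> u = y"
    and right_division: "\<lbrakk>x \<in> carrier Q; y \<in> carrier Q\<rbrakk> \<Longrightarrow> \<exists>!v. v \<in> carrier Q \<and> v \<otimes> x = y"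

text \<open>\<open>ldiv Q x y\<close> is $x\backslash y$ and \<open>rdiv Q y x\<close> is $y/x$.\<close>

definition ldiv :: "('a, 'b) monoid_scheme \<Rightarrow> 'a \<Rightarrow> 'a \<Rightarrow> 'a" where
  "ldiv Q x y = (THE u. u \<in> carrier Q \<and> x \<otimes>\<^bsub>Q\<^esub> u = y)"

definition rdiv :: "('a, 'b) monoid_scheme \<Rightarrow> 'a \<Rightarrow> 'a \<Rightarrow> 'a" where
  "rdiv Q y x = (THE v. v \<in> carrier Q \<and> v \<otimes>\<^bsub>Q\<^esub> x = y)"

locale cc_loop = loop +
  assumes left_conjugacy_closed:
    "\<exists>f. (\<forall>x\<in>carrier Q. \<forall>y\<in>carrier Q. f x y \<in> carrier Q) \<and>
      (\<forall>x\<in>carrier Q. \<forall>y\<in>carrier Q. \<forall>z\<in>carrier Q. x \<otimes> (y \<otimes> z) = f x y \<otimes> (x \<otimes> z))"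
    and right_conjugacy_closed:
    "\<exists>g. (\<forall>x\<in>carrier Q. \<forall>y\<in>carrier Q. g x y \<in> carrier Q) \<and>
      (\<forall>x\<in>carrier Q. \<forall>y\<in>carrier Q. \<forall>z\<in>carrier Q. (z \<otimes> y) \<otimes> x = (z \<otimes> x) \<otimes> g x y)"

definition subloop :: "'a set \<Rightarrow> ('a, 'b) monoid_scheme \<Rightarrow> bool" where
  "subloop H Q \<longleftrightarrow> H \<subseteq> carrier Q \<and> \<one>\<^bsub>Q\<^esub> \<in> H \<and>
    (\<forall>x\<in>H. \<forall>y\<in>H. x \<otimes>\<^bsub>Q\<^esub> y \<in> H \<and> ldiv Q x y \<in> H \<and> rdiv Q y x \<in> H)"

definition subloop_generated :: "('a, 'b) monoid_scheme \<Rightarrow> 'a set \<Rightarrow> 'a set" where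
  "subloop_generated Q S = \<Inter>{H. subloop H Q \<and> S \<subseteq> H}"

definition power_associative_elem :: "('a, 'b) monoid_scheme \<Rightarrow> 'a \<Rightarrow> bool" where
  "power_associative_elem Q a \<longleftrightarrow> group (Q\<lparr>carrier := subloop_generated Q {a}\<rparr>)"

definition WIP_elem :: "('a, 'b) monoid_scheme \<Rightarrow> 'a \<Rightarrow> bool" where
  "WIP_elem Q c \<longleftrightarrow>
    (\<forall>x\<in>carrier Q. c \<otimes>\<^bsub>Q\<^esub> ldiv Q (x \<otimes>\<^bsub>Q\<^esub> c) \<one>\<^bsub>Q\<^esub> = ldiv Q x \<one>\<^bsub>Q\<^esub>)"

end

theory Submission
  imports Defs
begin

text \<open>
  Write \<open>(xy)z = (x(yz))[x,y,z]\<close>. In a CC-loop, commutators lie in the nucleus \<open>N\<close>, so \<open>Q/N\<close> is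
  an abelian group; the associator takes values in the centre of \<open>N\<close>, depends only on cosets of
  \<open>N\<close>, is symmetric, and satisfies \<open>[z,w,uv] = [z,w,v] [z,w,u]\<^sup>v\<close>, where \<open>n v = v n\<^sup>v\<close>. The WIP
  condition on \<open>c\<close> amounts to \<open>[x,c,xc] = 1\<close> for all \<open>x\<close>, and polarisation yields \<open>[x,y,cc] = 1\<close>:
  the square of a WIP element is nuclear. It remains that \<open>[b,b,b] = 1\<close> propagates to the subloop
  generated by \<open>b\<close> and a nuclear element, one argument of the associator at a time.
\<close>

section \<open>Division, the nucleus, associators and conjugation in a loop\<close>

context loop
begin

lemma ldiv_props:
  assumes "x \<in> carrier Q" "y \<in> carrier Q"
  shows ldiv_closed: "ldiv Q x y \<in> carrier Q" and mult_ldiv: "x \<otimes> ldiv Q x y = y"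
  using theI'[OF left_division[OF assms]] unfolding ldiv_def by auto

lemma rdiv_props:
  assumes "x \<in> carrier Q" "y \<in> carrier Q"
  shows rdiv_closed: "rdiv Q y x \<in> carrier Q" and rdiv_mult: "rdiv Q y x \<otimes> x = y"
  using theI'[OF right_division[OF assms]] unfolding rdiv_def by auto

lemmas loop_simps [simp] =
  mult_closed one_closed mult_one_left mult_one_right ldiv_closed mult_ldiv rdiv_closed rdiv_mult

lemma left_cancel:
  "\<lbrakk>x \<otimes> u = x \<otimes> v; x \<in> carrier Q; u \<in> carrier Q; v \<in> carrier Q\<rbrakk> \<Longrightarrow> u = v"
  using left_division[of x "x \<otimes> v"] by auto

lemma right_cancel:
  "\<lbrakk>u \<otimes> x = v \<otimes> x; x \<in> carrier Q; u \<in> carrier Q; v \<in> carrier Q\<rbrakk> \<Longrightarrow> u = v"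
  using right_division[of x "v \<otimes> x"] by auto

lemma ldiv_eqI:
  "\<lbrakk>x \<otimes> u = y; x \<in> carrier Q; u \<in> carrier Q\<rbrakk> \<Longrightarrow> ldiv Q x y = u"
  using left_cancel[of x "ldiv Q x y" u] by auto

definition nucleus :: "'a set" where
  "nucleus = {n \<in> carrier Q. \<forall>x\<in>carrier Q. \<forall>y\<in>carrier Q.
     n \<otimes> (x \<otimes> y) = (n \<otimes> x) \<otimes> y \<and> x \<otimes> (n \<otimes> y) = (x \<otimes> n) \<otimes> y \<and> x \<otimes> (y \<otimes> n) = (x \<otimes> y) \<otimes> n}"

lemma nucleus_closed [simp]: "n \<in> nucleus \<Longrightarrow> n \<in> carrier Q"
  unfolding nucleus_def by blast

lemma nucleus_assoc:
  assumes "n \<in> nucleus" "x \<in> carrier Q" "y \<in> carrier Q"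
  shows nuc_left: "n \<otimes> (x \<otimes> y) = (n \<otimes> x) \<otimes> y"
    and nuc_mid: "x \<otimes> (n \<otimes> y) = (x \<otimes> n) \<otimes> y"
    and nuc_right: "x \<otimes> (y \<otimes> n) = (x \<otimes> y) \<otimes> n"
proof -
  have "\<forall>x\<in>carrier Q. \<forall>y\<in>carrier Q.
     n \<otimes> (x \<otimes> y) = (n \<otimes> x) \<otimes> y \<and> x \<otimes> (n \<otimes> y) = (x \<otimes> n) \<otimes> y \<and> x \<otimes> (y \<otimes> n) = (x \<otimes> y) \<otimes> n"
    using assms(1) unfolding nucleus_def mem_Collect_eq by (rule conjunct2)
  note * = this[rule_format, OF assms(2,3)]
  from * show "n \<otimes> (x \<otimes> y) = (n \<otimes> x) \<otimes> y" by (rule conjunct1)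
  from * show "x \<otimes> (n \<otimes> y) = (x \<otimes> n) \<otimes> y" by (elim conjE)
  from * show "x \<otimes> (y \<otimes> n) = (x \<otimes> y) \<otimes> n" by (elim conjE)
qed

lemma one_nucleus [simp]: "\<one> \<in> nucleus"
  unfolding nucleus_def by simp

definition associator :: "'a \<Rightarrow> 'a \<Rightarrow> 'a \<Rightarrow> 'a" where
  "associator x y z = ldiv Q (x \<otimes> (y \<otimes> z)) ((x \<otimes> y) \<otimes> z)"

text \<open>The inverse of \<open>T\<^sub>x\<close>, where \<open>T\<^sub>x a = (x a) / x\<close>;
  in a group it sends \<open>a\<close> to \<open>x\<^sup>-\<^sup>1 a x\<close>.\<close>

definition conjugate :: "'a \<Rightarrow> 'a \<Rightarrow> 'a" where
  "conjugate x a = ldiv Q x (a \<otimes> x)"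

lemma associator_props:
  assumes "x \<in> carrier Q" "y \<in> carrier Q" "z \<in> carrier Q"
  shows associator_closed [simp]: "associator x y z \<in> carrier Q"
    and associator_eq: "(x \<otimes> y) \<otimes> z = (x \<otimes> (y \<otimes> z)) \<otimes> associator x y z"
  using assms by (simp_all add: associator_def)

lemma associator_eqI:
  "\<lbrakk>(x \<otimes> y) \<otimes> z = (x \<otimes> (y \<otimes> z)) \<otimes> a; x \<in> carrier Q; y \<in> carrier Q; z \<in> carrier Q; a \<in> carrier Q\<rbrakk>
    \<Longrightarrow> associator x y z = a"
  by (simp add: associator_def ldiv_eqI)

lemma associator_one_iff:
  assumes "x \<in> carrier Q" "y \<in> carrier Q" "z \<in> carrier Q"
  shows "associator x y z = \<one> \<longleftrightarrow> (x \<otimes> y) \<otimes> z = x \<otimes> (y \<otimes> z)"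
proof
  assume "associator x y z = \<one>"
  then show "(x \<otimes> y) \<otimes> z = x \<otimes> (y \<otimes> z)" using associator_eq[OF assms] assms by simp
next
  assume "(x \<otimes> y) \<otimes> z = x \<otimes> (y \<otimes> z)"
  then show "associator x y z = \<one>" using assms by (intro associator_eqI) simp_all
qed

lemma conjugate_props:
  assumes "x \<in> carrier Q" "a \<in> carrier Q"
  shows conjugate_closed [simp]: "conjugate x a \<in> carrier Q"
    and mult_conjugate: "a \<otimes> x = x \<otimes> conjugate x a"
  using assms by (simp_all add: conjugate_def)

lemma conjugate_eqI:
  "\<lbrakk>a \<otimes> x = x \<otimes> b; x \<in> carrier Q; a \<in> carrier Q; b \<in> carrier Q\<rbrakk> \<Longrightarrow> conjugate x a = b"
  by (simp add: conjugate_def ldiv_eqI)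

lemma conjugate_one [simp]: "x \<in> carrier Q \<Longrightarrow> conjugate x \<one> = \<one>"
  by (rule conjugate_eqI) auto

lemma conjugate_eq_one:
  "\<lbrakk>conjugate x a = \<one>; x \<in> carrier Q; a \<in> carrier Q\<rbrakk> \<Longrightarrow> a = \<one>"
  using mult_conjugate[of x a] right_cancel[of a x \<one>] by auto

end

section \<open>Conjugacy closure and the coincidence of the three nuclei\<close>

context cc_loop
begin

text \<open>Setting \<open>z = 1\<close> in the law shows that \<open>f x y\<close> solves
  \<open>f x y \<otimes> x = x \<otimes> y\<close>. Stating the law for any solution
  \<open>e\<close> eliminates the choice of \<open>f\<close>; the right-hand law is treated in the
  same way in \<open>rcc\<close>.\<close>

lemma lcc:
  assumes "e \<otimes> x = x \<otimes> y" "x \<in> carrier Q" "y \<in> carrier Q" "z \<in> carrier Q" "e \<in> carrier Q"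
  shows "x \<otimes> (y \<otimes> z) = e \<otimes> (x \<otimes> z)"
proof -
  obtain f where f: "\<And>x y. \<lbrakk>x \<in> carrier Q; y \<in> carrier Q\<rbrakk> \<Longrightarrow> f x y \<in> carrier Q"
    "\<And>x y z. \<lbrakk>x \<in> carrier Q; y \<in> carrier Q; z \<in> carrier Q\<rbrakk> \<Longrightarrow> x \<otimes> (y \<otimes> z) = f x y \<otimes> (x \<otimes> z)"
    using left_conjugacy_closed by blast
  have "f x y \<otimes> x = e \<otimes> x" using f(2)[of x y \<one>] assms by simp
  then have "f x y = e" using right_cancel f(1) assms by blast
  then show ?thesis using f(2) assms by blast
qed

lemma rcc:
  assumes "x \<otimes> g = y \<otimes> x" "x \<in> carrier Q" "y \<in> carrier Q" "z \<in> carrier Q" "g \<in> carrier Q"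
  shows "(z \<otimes> y) \<otimes> x = (z \<otimes> x) \<otimes> g"
proof -
  obtain h where h: "\<And>x y. \<lbrakk>x \<in> carrier Q; y \<in> carrier Q\<rbrakk> \<Longrightarrow> h x y \<in> carrier Q"
    "\<And>x y z. \<lbrakk>x \<in> carrier Q; y \<in> carrier Q; z \<in> carrier Q\<rbrakk> \<Longrightarrow> (z \<otimes> y) \<otimes> x = (z \<otimes> x) \<otimes> h x y"
    using right_conjugacy_closed by blast
  have "x \<otimes> h x y = x \<otimes> g" using h(2)[of x y \<one>] assms by simp
  then have "h x y = g" using left_cancel h(1) assms by blast
  then show ?thesis using h(2) assms by blast
qed

text \<open>If \<open>e n = n x\<close>, then \<open>n (x y) = e (n y) = (e n) y = (n x) y\<close>,
  by conjugacy closure and then middle nuclearity. The next three lemmas use the same device with a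
  suitable conjugate, so each one-sided associativity condition implies the other two.\<close>

lemma middle_imp_left_nuclear:
  assumes n: "n \<in> carrier Q" and mid: "\<And>x y. \<lbrakk>x \<in> carrier Q; y \<in> carrier Q\<rbrakk> \<Longrightarrow> x \<otimes> (n \<otimes> y) = (x \<otimes> n) \<otimes> y"
    and x: "x \<in> carrier Q" and y: "y \<in> carrier Q"
  shows "n \<otimes> (x \<otimes> y) = (n \<otimes> x) \<otimes> y"
proof -
  define e where "e = rdiv Q (n \<otimes> x) n"
  have e: "e \<in> carrier Q" "e \<otimes> n = n \<otimes> x" using n x by (auto simp: e_def)
  show ?thesis using lcc[OF e(2) n x y e(1)] mid[OF e(1) y] e by simp
qed

lemma left_imp_middle_nuclear:
  assumes n: "n \<in> carrier Q" and left: "\<And>x y. \<lbrakk>x \<in> carrier Q; y \<in> carrier Q\<rbrakk> \<Longrightarrow> n \<otimes> (x \<otimes> y) = (n \<otimes> x) \<otimes> y"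
    and x: "x \<in> carrier Q" and y: "y \<in> carrier Q"
  shows "x \<otimes> (n \<otimes> y) = (x \<otimes> n) \<otimes> y"
proof -
  define w where "w = ldiv Q n (x \<otimes> n)"
  have w: "w \<in> carrier Q" "x \<otimes> n = n \<otimes> w" using n x by (auto simp: w_def)
  show ?thesis using lcc[OF w(2) n w(1) y x] left[OF w(1) y] w by simp
qed

lemma middle_imp_right_nuclear:
  assumes n: "n \<in> carrier Q" and mid: "\<And>x y. \<lbrakk>x \<in> carrier Q; y \<in> carrier Q\<rbrakk> \<Longrightarrow> x \<otimes> (n \<otimes> y) = (x \<otimes> n) \<otimes> y"
    and x: "x \<in> carrier Q" and y: "y \<in> carrier Q"
  shows "x \<otimes> (y \<otimes> n) = (x \<otimes> y) \<otimes> n"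
proof -
  define g where "g = ldiv Q n (y \<otimes> n)"
  have g: "g \<in> carrier Q" "n \<otimes> g = y \<otimes> n" using n y by (auto simp: g_def)
  show ?thesis using rcc[OF g(2) n y x g(1)] mid[OF x g(1)] g by simp
qed

lemma right_imp_middle_nuclear:
  assumes n: "n \<in> carrier Q" and right: "\<And>x y. \<lbrakk>x \<in> carrier Q; y \<in> carrier Q\<rbrakk> \<Longrightarrow> x \<otimes> (y \<otimes> n) = (x \<otimes> y) \<otimes> n"
    and x: "x \<in> carrier Q" and y: "y \<in> carrier Q"
  shows "x \<otimes> (n \<otimes> y) = (x \<otimes> n) \<otimes> y"
proof -
  define w where "w = rdiv Q (n \<otimes> y) n"
  have w: "w \<in> carrier Q" "n \<otimes> y = w \<otimes> n" using n y by (auto simp: w_def)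
  show ?thesis using rcc[OF w(2) n w(1) x y] right[OF x w(1)] w by simp
qed

lemma nucleusI_middle:
  assumes "n \<in> carrier Q" "\<And>x y. \<lbrakk>x \<in> carrier Q; y \<in> carrier Q\<rbrakk> \<Longrightarrow> x \<otimes> (n \<otimes> y) = (x \<otimes> n) \<otimes> y"
  shows "n \<in> nucleus"
  unfolding nucleus_def
  using assms middle_imp_left_nuclear[OF assms] middle_imp_right_nuclear[OF assms] by blast

lemma nucleusI_left:
  assumes "n \<in> carrier Q" "\<And>x y. \<lbrakk>x \<in> carrier Q; y \<in> carrier Q\<rbrakk> \<Longrightarrow> n \<otimes> (x \<otimes> y) = (n \<otimes> x) \<otimes> y"
  shows "n \<in> nucleus"
  using nucleusI_middle left_imp_middle_nuclear[OF assms] assms(1) by blast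

lemma nucleusI_right:
  assumes "n \<in> carrier Q" "\<And>x y. \<lbrakk>x \<in> carrier Q; y \<in> carrier Q\<rbrakk> \<Longrightarrow> x \<otimes> (y \<otimes> n) = (x \<otimes> y) \<otimes> n"
  shows "n \<in> nucleus"
  using nucleusI_middle right_imp_middle_nuclear[OF assms] assms(1) by blast

section \<open>The nucleus as a normal subgroup containing the commutators\<close>

lemma nucleus_mult [simp]:
  assumes m: "m \<in> nucleus" and n: "n \<in> nucleus"
  shows "m \<otimes> n \<in> nucleus"
proof (rule nucleusI_left)
  fix x y assume xy: "x \<in> carrier Q" "y \<in> carrier Q"
  have "(m \<otimes> n) \<otimes> (x \<otimes> y) = m \<otimes> (n \<otimes> (x \<otimes> y))" using m n xy by (simp add: nuc_left[OF m])
  also have "\<dots> = ((m \<otimes> n) \<otimes> x) \<otimes> y" using m n xy by (simp add: nuc_left)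
  finally show "(m \<otimes> n) \<otimes> (x \<otimes> y) = ((m \<otimes> n) \<otimes> x) \<otimes> y" .
qed (use m n in simp)

lemma nucleus_inverse:
  assumes n: "n \<in> nucleus"
  obtains n' where "n' \<in> nucleus" "n' \<otimes> n = \<one>"
proof -
  define n' where "n' = ldiv Q n \<one>"
  have c: "n \<in> carrier Q" "n' \<in> carrier Q" "n \<otimes> n' = \<one>" using n by (auto simp: n'_def)
  have inv: "n \<otimes> (n' \<otimes> x) = x" if "x \<in> carrier Q" for x
    using c n that by (simp add: nuc_left)
  have "n' \<in> nucleus"
  proof (rule nucleusI_left)
    fix x y assume xy: "x \<in> carrier Q" "y \<in> carrier Q"
    have "n \<otimes> (n' \<otimes> (x \<otimes> y)) = n \<otimes> ((n' \<otimes> x) \<otimes> y)"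
      using inv xy c n by (simp add: nuc_left[OF n, of "n' \<otimes> x"])
    then show "n' \<otimes> (x \<otimes> y) = (n' \<otimes> x) \<otimes> y" using left_cancel c xy by (meson mult_closed)
  qed (use c in simp)
  moreover have "n' \<otimes> n = \<one>"
    using left_cancel[of n "n' \<otimes> n" \<one>] inv[of n] c by simp
  ultimately show ?thesis using that by blast
qed

text \<open>With \<open>T\<^sub>x = R\<^sub>x\<^sup>-\<^sup>1 L\<^sub>x\<close>, the triples \<open>A\<^sub>x = (T\<^sub>x, L\<^sub>x, L\<^sub>x)\<close> and
  \<open>B\<^sub>x = (R\<^sub>x, T\<^sub>x\<^sup>-\<^sup>1, R\<^sub>x)\<close> are autotopisms. For \<open>w = xy\<close>, this is the autotopism
  \<open>B\<^sub>y A\<^sub>x B\<^sub>y\<^sup>-\<^sup>1 A\<^sub>y A\<^sub>w\<^sup>-\<^sup>1\<close>, whose third component is the identity.\<close>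

lemma commutator_autotopism:
  assumes u: "u \<in> carrier Q" and w: "w \<in> carrier Q" and y: "y \<in> carrier Q"
  obtains p where "p \<in> carrier Q"
    "\<And>v. v \<in> carrier Q \<Longrightarrow> u \<otimes> (w \<otimes> v) = p \<otimes> ldiv Q y (w \<otimes> (y \<otimes> v))"
proof -
  define x where "x = rdiv Q w y"
  \<comment> \<open>Reading the composition from right to left, \<open>u0\<close>, \<open>s\<close>,
    \<open>r\<close>, \<open>q\<close> and finally \<open>q \<otimes> y\<close> are the successive
    images of \<open>u\<close> under the first components. In the same way \<open>v\<close>,
    \<open>y \<otimes> v\<close>, \<open>t\<close>, \<open>x \<otimes> t\<close>, \<open>g\<close>
    are the images of \<open>w \<otimes> v\<close> under the second components.\<close>
  define u0 where "u0 = ldiv Q w (u \<otimes> w)"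
  define s where "s = rdiv Q (y \<otimes> u0) y"
  define r where "r = rdiv Q s y"
  define q where "q = rdiv Q (x \<otimes> r) x"
  have x: "x \<in> carrier Q" "x \<otimes> y = w" using w y by (auto simp: x_def)
  have u0: "u0 \<in> carrier Q" "u \<otimes> w = w \<otimes> u0" using w u by (auto simp: u0_def)
  have s: "s \<in> carrier Q" "s \<otimes> y = y \<otimes> u0" using y u0 by (auto simp: s_def)
  have r: "r \<in> carrier Q" "r \<otimes> y = s" using y s by (auto simp: r_def)
  have q: "q \<in> carrier Q" "q \<otimes> x = x \<otimes> r" using x r by (auto simp: q_def)
  show ?thesis
  proof (rule that[of "q \<otimes> y"])
    fix v assume v: "v \<in> carrier Q"
    define t where "t = rdiv Q (y \<otimes> (y \<otimes> v)) y"
    have t: "t \<in> carrier Q" "y \<otimes> (y \<otimes> v) = t \<otimes> y" using y v by (auto simp: t_def)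
    define g where "g = ldiv Q y ((x \<otimes> t) \<otimes> y)"
    have g: "g \<in> carrier Q" "y \<otimes> g = (x \<otimes> t) \<otimes> y" using y x t by (auto simp: g_def)
    have xt: "(x \<otimes> t) \<otimes> y = w \<otimes> (y \<otimes> v)"
      using rcc[OF t(2) y t(1) x(1)] x y v by simp
    have rt: "(r \<otimes> t) \<otimes> y = y \<otimes> (u0 \<otimes> v)"
      using rcc[OF t(2) y t(1) r(1)] lcc[OF s(2) y u0(1) v s(1)] r y v by simp
    have "u \<otimes> (w \<otimes> v) = w \<otimes> (u0 \<otimes> v)"
      using lcc[OF u0(2) w u0(1) v u] by simp
    also have "\<dots> = (x \<otimes> (r \<otimes> t)) \<otimes> y"
      using rcc[OF rt[symmetric] y _ x(1)] x r t u0 v by simp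
    also have "\<dots> = (q \<otimes> (x \<otimes> t)) \<otimes> y"
      using lcc[OF q(2) x(1) r(1) t(1) q(1)] by simp
    also have "\<dots> = (q \<otimes> y) \<otimes> g"
      using rcc[OF g(2) y _ q(1) g(1)] x t by simp
    finally show "u \<otimes> (w \<otimes> v) = (q \<otimes> y) \<otimes> ldiv Q y (w \<otimes> (y \<otimes> v))"
      using xt by (simp add: g_def)
  qed (use q y in simp)
qed

lemma commutator_nuclear:
  assumes eq: "w \<otimes> y = y \<otimes> t" and w: "w \<in> carrier Q" and y: "y \<in> carrier Q" and t: "t \<in> carrier Q"
  obtains m where "m \<in> nucleus" "w = m \<otimes> t"
proof -
  obtain m where m: "m \<in> carrier Q"
    and m': "\<And>v. v \<in> carrier Q \<Longrightarrow> \<one> \<otimes> (w \<otimes> v) = m \<otimes> ldiv Q y (w \<otimes> (y \<otimes> v))"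
    using commutator_autotopism[OF one_closed w y] by blast
  have "u \<otimes> (m \<otimes> z) = (u \<otimes> m) \<otimes> z" if u: "u \<in> carrier Q" and z: "z \<in> carrier Q" for u z
  proof -
    obtain p where p: "p \<in> carrier Q"
      and p': "\<And>v. v \<in> carrier Q \<Longrightarrow> u \<otimes> (w \<otimes> v) = p \<otimes> ldiv Q y (w \<otimes> (y \<otimes> v))"
      using commutator_autotopism[OF u w y] by blast
    have *: "u \<otimes> (m \<otimes> a) = p \<otimes> a" if a: "a \<in> carrier Q" for a
    proof -
      define v where "v = ldiv Q w (m \<otimes> a)"
      have v: "v \<in> carrier Q" "w \<otimes> v = m \<otimes> a" using w m a by (auto simp: v_def)
      have "m \<otimes> ldiv Q y (w \<otimes> (y \<otimes> v)) = m \<otimes> a" using m'[OF v(1)] v m a by simp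
      then have "ldiv Q y (w \<otimes> (y \<otimes> v)) = a"
        using left_cancel[OF _ m _ a] w y v by simp
      then show ?thesis using p'[OF v(1)] v by simp
    qed
    show ?thesis using *[OF z] *[OF one_closed] p m by simp
  qed
  then have "m \<in> nucleus" using nucleusI_middle m by blast
  moreover have "w = m \<otimes> t"
    using m'[OF one_closed] eq ldiv_eqI[OF _ y t] w y by simp
  ultimately show ?thesis using that by blast
qed

lemma conjugate_nucleus [simp]:
  assumes n: "n \<in> nucleus" and x: "x \<in> carrier Q"
  shows "conjugate x n \<in> nucleus"
proof -
  have nc: "n \<in> carrier Q" and cc: "conjugate x n \<in> carrier Q" using n x by auto
  obtain m where m: "m \<in> nucleus" "n = m \<otimes> conjugate x n"
    using commutator_nuclear[OF mult_conjugate[OF x nc] nc x cc] by blast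
  obtain m' where m': "m' \<in> nucleus" "m' \<otimes> m = \<one>" using nucleus_inverse m by blast
  have "m' \<otimes> n = m' \<otimes> (m \<otimes> conjugate x n)" using m(2) by simp
  also have "\<dots> = conjugate x n" using nuc_left[OF m'(1), of m] m(1) m'(2) cc by simp
  finally have "m' \<otimes> n = conjugate x n" .
  then show ?thesis using nucleus_mult m' n by metis
qed

text \<open>Normality again: the conjugate \<open>e = (x n)/x\<close> differs from \<open>n\<close>
  by a nuclear factor, so it is nuclear.\<close>

lemma nucleus_move_left:
  assumes n: "n \<in> nucleus" and x: "x \<in> carrier Q"
  obtains n' where "n' \<in> nucleus" "x \<otimes> n = n' \<otimes> x"
proof -
  define e where "e = rdiv Q (x \<otimes> n) x"
  have e: "e \<in> carrier Q" "e \<otimes> x = x \<otimes> n" using n x by (auto simp: e_def)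
  obtain m where "m \<in> nucleus" "e = m \<otimes> n"
    using commutator_nuclear[OF e(2) e(1) x] n by auto
  then show ?thesis using that[of e] e n by simp
qed

section \<open>Congruence modulo the nucleus and the abelian quotient\<close>

text \<open>Equality of cosets of the nucleus. The factor is written on the left; normality makes
  the side immaterial.\<close>

definition eqv :: "'a \<Rightarrow> 'a \<Rightarrow> bool" where
  "eqv x y \<longleftrightarrow> y \<in> carrier Q \<and> (\<exists>n\<in>nucleus. x = n \<otimes> y)"

lemma eqvI: "\<lbrakk>n \<in> nucleus; x = n \<otimes> y; y \<in> carrier Q\<rbrakk> \<Longrightarrow> eqv x y"
  unfolding eqv_def by blast

lemma eqvE:
  assumes "eqv x y"
  obtains n where "n \<in> nucleus" "x = n \<otimes> y" "x \<in> carrier Q" "y \<in> carrier Q"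
  using assms mult_closed nucleus_closed unfolding eqv_def by blast

lemma eqv_sym:
  assumes "eqv x y"
  shows "eqv y x"
proof -
  obtain n where n: "n \<in> nucleus" "x = n \<otimes> y" and xy: "x \<in> carrier Q" "y \<in> carrier Q"
    using assms by (rule eqvE)
  obtain n' where n': "n' \<in> nucleus" "n' \<otimes> n = \<one>" using nucleus_inverse[OF n(1)] .
  have "y = n' \<otimes> x" using nuc_left[OF n'(1), of n y] n n' xy by simp
  then show ?thesis using eqvI n' xy by blast
qed

lemma eqv_trans [trans]:
  assumes xy: "eqv x y" and yz: "eqv y z"
  shows "eqv x z"
proof -
  obtain m where m: "m \<in> nucleus" "x = m \<otimes> y" using xy by (rule eqvE)
  obtain n where n: "n \<in> nucleus" "y = n \<otimes> z" and z: "z \<in> carrier Q" using yz by (rule eqvE)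
  have "x = (m \<otimes> n) \<otimes> z" using nuc_left[OF m(1), of n z] m n z by simp
  then show ?thesis using eqvI[of "m \<otimes> n"] m n z by simp
qed

lemma eqv_mult_left:
  assumes xy: "eqv x y" and z: "z \<in> carrier Q"
  shows "eqv (z \<otimes> x) (z \<otimes> y)"
proof -
  obtain n where n: "n \<in> nucleus" "x = n \<otimes> y" and y: "y \<in> carrier Q" using xy by (rule eqvE)
  obtain n' where n': "n' \<in> nucleus" "z \<otimes> n = n' \<otimes> z" using nucleus_move_left[OF n(1) z] .
  have "z \<otimes> x = n' \<otimes> (z \<otimes> y)"
    using nuc_mid[OF n(1) z y] nuc_left[OF n'(1) z y] n n' by simp
  then show ?thesis using eqvI n' y z by simp
qed

lemma eqv_mult_right:
  assumes xy: "eqv x y" and z: "z \<in> carrier Q"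
  shows "eqv (x \<otimes> z) (y \<otimes> z)"
proof -
  obtain n where n: "n \<in> nucleus" "x = n \<otimes> y" and y: "y \<in> carrier Q" using xy by (rule eqvE)
  show ?thesis using eqvI[OF n(1) _ mult_closed[OF y z]] nuc_left[OF n(1) y z] n(2) by simp
qed

lemma eqv_conjugate:
  assumes "w \<otimes> y = y \<otimes> t" "w \<in> carrier Q" "y \<in> carrier Q" "t \<in> carrier Q"
  shows "eqv w t"
proof -
  obtain m where "m \<in> nucleus" "w = m \<otimes> t" using commutator_nuclear[OF assms] .
  then show ?thesis using eqvI assms(4) by blast
qed

lemma eqv_comm:
  assumes x: "x \<in> carrier Q" and y: "y \<in> carrier Q"
  shows "eqv (x \<otimes> y) (y \<otimes> x)"
proof -
  have "eqv (conjugate y x) x"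
    using eqv_sym[OF eqv_conjugate[OF mult_conjugate[OF y x]]] x y by simp
  then show ?thesis using eqv_mult_left[OF _ y] mult_conjugate[OF y x] by simp
qed

text \<open>Conjugacy closure gives \<open>x (y z) = e (x z)\<close> with \<open>e\<close> conjugate
  to \<open>y\<close>, hence congruent to it. Together with commutativity of the quotient this
  yields its associativity.\<close>

lemma eqv_left_comm:
  assumes x: "x \<in> carrier Q" and y: "y \<in> carrier Q" and z: "z \<in> carrier Q"
  shows "eqv (x \<otimes> (y \<otimes> z)) (y \<otimes> (x \<otimes> z))"
proof -
  define e where "e = rdiv Q (x \<otimes> y) x"
  have e: "e \<in> carrier Q" "e \<otimes> x = x \<otimes> y" using x y by (auto simp: e_def)
  have "eqv (e \<otimes> (x \<otimes> z)) (y \<otimes> (x \<otimes> z))"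
    using eqv_mult_right[OF eqv_conjugate[OF e(2) e(1) x y]] x z by simp
  then show ?thesis using lcc[OF e(2) x y z e(1)] by simp
qed

lemma eqv_assoc:
  assumes x: "x \<in> carrier Q" and y: "y \<in> carrier Q" and z: "z \<in> carrier Q"
  shows "eqv ((x \<otimes> y) \<otimes> z) (x \<otimes> (y \<otimes> z))"
proof -
  have "eqv ((x \<otimes> y) \<otimes> z) (z \<otimes> (x \<otimes> y))" using eqv_comm x y z by simp
  also have "eqv \<dots> (x \<otimes> (z \<otimes> y))" using eqv_left_comm x y z by simp
  also have "eqv \<dots> (x \<otimes> (y \<otimes> z))" using eqv_mult_left eqv_comm x y z by simp
  finally show ?thesis .
qed

section \<open>The associator: nuclear central values, coset invariance, symmetry, expansion\<close>

text \<open>Associativity modulo the nucleus supplies a nuclear factor to the left of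
  \<open>x (y z)\<close>; conjugation by \<open>x (y z)\<close> moves it to the right, where it is
  the associator.\<close>

lemma associator_nucleus [simp]:
  assumes x: "x \<in> carrier Q" and y: "y \<in> carrier Q" and z: "z \<in> carrier Q"
  shows "associator x y z \<in> nucleus"
proof -
  obtain n where n: "n \<in> nucleus" "(x \<otimes> y) \<otimes> z = n \<otimes> (x \<otimes> (y \<otimes> z))"
    using eqv_assoc[OF x y z] by (rule eqvE)
  then have "(x \<otimes> y) \<otimes> z = (x \<otimes> (y \<otimes> z)) \<otimes> conjugate (x \<otimes> (y \<otimes> z)) n"
    using mult_conjugate[of "x \<otimes> (y \<otimes> z)" n] x y z by simp
  then have "associator x y z = conjugate (x \<otimes> (y \<otimes> z)) n"
    using associator_eqI x y z n by simp
  then show ?thesis using n x y z by simp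
qed

text \<open>Both sides of the associator relation are translated on the left by the same nuclear element,
  hence the associator only depends on cosets of the nucleus.\<close>

lemma associator_eqv1:
  assumes "eqv x' x" and x: "x \<in> carrier Q" and y: "y \<in> carrier Q" and z: "z \<in> carrier Q"
  shows "associator x' y z = associator x y z"
proof -
  obtain n where n: "n \<in> nucleus" "x' = n \<otimes> x" using assms(1) by (rule eqvE)
  show ?thesis
  proof (rule associator_eqI)
    have "(x' \<otimes> y) \<otimes> z = n \<otimes> ((x \<otimes> y) \<otimes> z)" using n x y z by (simp add: nuc_left)
    also have "\<dots> = (n \<otimes> (x \<otimes> (y \<otimes> z))) \<otimes> associator x y z"
      using nuc_left[OF n(1), of "x \<otimes> (y \<otimes> z)"] associator_eq[OF x y z] x y z by simp
    also have "n \<otimes> (x \<otimes> (y \<otimes> z)) = x' \<otimes> (y \<otimes> z)" using n x y z by (simp add: nuc_left)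
    finally show "(x' \<otimes> y) \<otimes> z = (x' \<otimes> (y \<otimes> z)) \<otimes> associator x y z" .
  qed (use n x y z in simp_all)
qed

lemma associator_eqv2:
  assumes "eqv y' y" and x: "x \<in> carrier Q" and y: "y \<in> carrier Q" and z: "z \<in> carrier Q"
  shows "associator x y' z = associator x y z"
proof -
  obtain n where n: "n \<in> nucleus" "y' = n \<otimes> y" using assms(1) by (rule eqvE)
  obtain n' where n': "n' \<in> nucleus" "x \<otimes> n = n' \<otimes> x" using nucleus_move_left n x by blast
  have move: "x \<otimes> (n \<otimes> v) = n' \<otimes> (x \<otimes> v)" if "v \<in> carrier Q" for v
    using that n n' x by (simp add: nuc_mid nuc_left)
  show ?thesis
  proof (rule associator_eqI)
    have "(x \<otimes> y') \<otimes> z = n' \<otimes> ((x \<otimes> y) \<otimes> z)" using n n' move x y z by (simp add: nuc_left)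
    also have "\<dots> = (n' \<otimes> (x \<otimes> (y \<otimes> z))) \<otimes> associator x y z"
      using nuc_left[OF n'(1), of "x \<otimes> (y \<otimes> z)"] associator_eq[OF x y z] x y z by simp
    also have "n' \<otimes> (x \<otimes> (y \<otimes> z)) = x \<otimes> (y' \<otimes> z)"
      using n move[of "y \<otimes> z"] x y z by (simp add: nuc_left)
    finally show "(x \<otimes> y') \<otimes> z = (x \<otimes> (y' \<otimes> z)) \<otimes> associator x y z" .
  qed (use n x y z in simp_all)
qed

text \<open>For \<open>e x = x y\<close> one has \<open>(x y) z = (e x) z\<close> and
  \<open>e (x z) = x (y z)\<close>, so \<open>[x,y,z] = [e,x,z]\<close>; and \<open>e\<close> lies
  in the coset of \<open>y\<close>.\<close>

lemma associator_swap_left: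
  assumes x: "x \<in> carrier Q" and y: "y \<in> carrier Q" and z: "z \<in> carrier Q"
  shows "associator x y z = associator y x z"
proof (rule associator_eqI[OF _ x y z])
  define e where "e = rdiv Q (x \<otimes> y) x"
  have e: "e \<in> carrier Q" "e \<otimes> x = x \<otimes> y" using x y by (auto simp: e_def)
  have "(x \<otimes> y) \<otimes> z = (e \<otimes> x) \<otimes> z" using e by simp
  also have "\<dots> = (e \<otimes> (x \<otimes> z)) \<otimes> associator e x z" using associator_eq[OF e(1) x z] .
  also have "associator e x z = associator y x z"
    using associator_eqv1 eqv_conjugate[OF e(2) e(1) x y] x y z by simp
  also have "e \<otimes> (x \<otimes> z) = x \<otimes> (y \<otimes> z)" using lcc[OF e(2) x y z e(1)] by simp
  finally show "(x \<otimes> y) \<otimes> z = (x \<otimes> (y \<otimes> z)) \<otimes> associator y x z" .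
qed (use x y z in simp)

lemma associator_eqv3:
  assumes "eqv z' z" and x: "x \<in> carrier Q" and y: "y \<in> carrier Q" and z: "z \<in> carrier Q"
  shows "associator x y z' = associator x y z"
proof -
  obtain n where n: "n \<in> nucleus" "z' = n \<otimes> z" using assms(1) by (rule eqvE)
  obtain n' where n': "n' \<in> nucleus" "y \<otimes> n = n' \<otimes> y" using nucleus_move_left n y by blast
  \<comment> \<open>\<open>n2\<close> is \<open>n\<close> carried to the left past \<open>y\<close>
    and then past \<open>x\<close>; by nuclearity the same element results for both bracketings of
    \<open>x\<close>, \<open>y\<close>, \<open>z\<close>.\<close>
  obtain n2 where n2: "n2 \<in> nucleus" "x \<otimes> n' = n2 \<otimes> x" using nucleus_move_left n' x by blast
  have r: "x \<otimes> (y \<otimes> z') = n2 \<otimes> (x \<otimes> (y \<otimes> z))"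
  proof -
    have "y \<otimes> z' = n' \<otimes> (y \<otimes> z)" using n n' y z by (simp add: nuc_mid nuc_left)
    then show ?thesis using n' n2 x y z by (simp add: nuc_mid nuc_left[OF n2(1), of x])
  qed
  have l: "(x \<otimes> y) \<otimes> z' = n2 \<otimes> ((x \<otimes> y) \<otimes> z)"
  proof -
    have "(x \<otimes> y) \<otimes> n = (n2 \<otimes> x) \<otimes> y"
    proof -
      have "(x \<otimes> y) \<otimes> n = x \<otimes> (n' \<otimes> y)" using nuc_right[OF n(1) x y] n' by simp
      also have "\<dots> = (n2 \<otimes> x) \<otimes> y" using nuc_mid[OF n'(1) x y] n2 by simp
      finally show ?thesis .
    qed
    then show ?thesis using n n2 x y z by (simp add: nuc_mid nuc_left)
  qed
  show ?thesis
  proof (rule associator_eqI)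
    show "(x \<otimes> y) \<otimes> z' = (x \<otimes> (y \<otimes> z')) \<otimes> associator x y z"
      unfolding l r
      using nuc_left[OF n2(1), of "x \<otimes> (y \<otimes> z)"] associator_eq[OF x y z] x y z by simp
  qed (use n x y z in simp_all)
qed

text \<open>Dually, if \<open>y z = z g\<close>, then \<open>(x y) z = (x z) g\<close> and
  \<open>x (z g) = x (y z)\<close>, so \<open>[x,y,z] = [x,z,g]\<close> with \<open>g\<close> in the
  coset of \<open>y\<close>.\<close>

lemma associator_swap_right:
  assumes x: "x \<in> carrier Q" and y: "y \<in> carrier Q" and z: "z \<in> carrier Q"
  shows "associator x y z = associator x z y"
proof (rule associator_eqI[OF _ x y z])
  define g where "g = conjugate z y"
  have g: "g \<in> carrier Q" "y \<otimes> z = z \<otimes> g"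
    unfolding g_def using mult_conjugate[OF z y] y z by simp_all
  have "eqv g y" using eqv_sym[OF eqv_conjugate[OF g(2) y z g(1)]] .
  then have a: "associator x z g = associator x z y" using associator_eqv3 x y z by simp
  have "(x \<otimes> y) \<otimes> z = (x \<otimes> z) \<otimes> g" using rcc[OF g(2)[symmetric] z y x g(1)] .
  also have "\<dots> = (x \<otimes> (z \<otimes> g)) \<otimes> associator x z g" using associator_eq[OF x z g(1)] .
  finally show "(x \<otimes> y) \<otimes> z = (x \<otimes> (y \<otimes> z)) \<otimes> associator x z y" using a g by simp
qed (use x y z in simp)

lemma associator_swap_outer:
  assumes "x \<in> carrier Q" "y \<in> carrier Q" "z \<in> carrier Q"
  shows "associator x y z = associator z y x"
  using associator_swap_left associator_swap_right assms by metis

text \<open>Evaluate \<open>(x y) (z k)\<close> twice, with \<open>a = [x,y,z]\<close>: splitting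
  off \<open>k\<close> first gives \<open>(x (y z)) (a k)\<close>, while
  \<open>[x,y,z k] = a\<close> gives \<open>(x (y z)) (k a)\<close>.\<close>

lemma associator_central:
  assumes x: "x \<in> carrier Q" and y: "y \<in> carrier Q" and z: "z \<in> carrier Q" and k: "k \<in> nucleus"
  shows "k \<otimes> associator x y z = associator x y z \<otimes> k"
proof -
  define a where "a = associator x y z"
  have a: "a \<in> nucleus" using x y z by (simp add: a_def)
  obtain j where j: "j \<in> nucleus" "z \<otimes> k = j \<otimes> z" using nucleus_move_left k z by blast
  have "((x \<otimes> (y \<otimes> z)) \<otimes> a) \<otimes> k = (x \<otimes> y) \<otimes> (z \<otimes> k)"
    using nuc_right[OF k, of "x \<otimes> y" z] x y z by (simp add: a_def flip: associator_eq)
  also have "\<dots> = (x \<otimes> (y \<otimes> (z \<otimes> k))) \<otimes> associator x y (z \<otimes> k)"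
    using associator_eq[OF x y, of "z \<otimes> k"] z k by simp
  also have "associator x y (z \<otimes> k) = a"
    using associator_eqv3[OF eqvI[OF j z] x y z] by (simp add: a_def)
  also have "x \<otimes> (y \<otimes> (z \<otimes> k)) = (x \<otimes> (y \<otimes> z)) \<otimes> k"
    using nuc_right[OF k] x y z by simp
  finally have "(x \<otimes> (y \<otimes> z)) \<otimes> (a \<otimes> k) = (x \<otimes> (y \<otimes> z)) \<otimes> (k \<otimes> a)"
    using a k x y z by (simp add: nuc_right)
  then have "a \<otimes> k = k \<otimes> a" by (rule left_cancel) (use a k x y z in simp_all)
  then show ?thesis by (simp add: a_def)
qed

text \<open>This expresses that the inner mapping \<open>L\<^sub>z\<^sub>w\<^sup>-\<^sup>1 L\<^sub>z L\<^sub>w\<close>, which sends \<open>u\<close> to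
  \<open>u (associator z w u)\<^sup>-\<^sup>1\<close>, is an automorphism.\<close>

lemma associator_mult:
  assumes z: "z \<in> carrier Q" and w: "w \<in> carrier Q" and u: "u \<in> carrier Q" and v: "v \<in> carrier Q"
  shows "associator z w (u \<otimes> v) = associator z w v \<otimes> conjugate v (associator z w u)"
proof -
  define S where "S = z \<otimes> w"
  define a where "a = associator z w u"
  define b where "b = associator z w v"
  have S: "S \<in> carrier Q" using z w by (simp add: S_def)
  have a: "a \<in> nucleus" and b: "b \<in> nucleus" using z w u v by (simp_all add: a_def b_def)
  define e1 where "e1 = rdiv Q (w \<otimes> u) w"
  have e1: "e1 \<in> carrier Q" "e1 \<otimes> w = w \<otimes> u" using w u by (auto simp: e1_def)
  \<comment> \<open>\<open>e = T\<^sub>z (T\<^sub>w u)\<close>, so that applying left conjugacy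
    closure for \<open>w\<close> and then for \<open>z\<close> gives \<open>eL\<close>.\<close>
  define e where "e = rdiv Q (z \<otimes> e1) z"
  have e: "e \<in> carrier Q" "e \<otimes> z = z \<otimes> e1" using z e1 by (auto simp: e_def)
  have eL: "z \<otimes> (w \<otimes> (u \<otimes> t)) = e \<otimes> (z \<otimes> (w \<otimes> t))" if "t \<in> carrier Q" for t
    using lcc[OF e1(2) w u that e1(1)] lcc[OF e(2) z e1(1) _ e(1), of "w \<otimes> t"] w that by simp
  obtain a' where a': "a' \<in> nucleus" "S \<otimes> a = a' \<otimes> S" using nucleus_move_left a S by blast
  \<comment> \<open>This identifies \<open>e \<otimes> a'\<close> as \<open>T\<^sub>S u\<close>.
    Conjugacy closure for \<open>S\<close> then compares \<open>S (u v)\<close> with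
    \<open>z (w (u v))\<close>.\<close>
  have Su: "(e \<otimes> a') \<otimes> S = S \<otimes> u"
  proof -
    have "S \<otimes> u = (e \<otimes> S) \<otimes> a"
      using associator_eq[OF z w u] eL[OF one_closed] z w u by (simp add: S_def a_def)
    also have "\<dots> = e \<otimes> (a' \<otimes> S)" using a a' e S by (simp flip: nuc_right)
    finally show ?thesis using a' e S by (simp add: nuc_mid)
  qed
  have Sv: "S \<otimes> v = (z \<otimes> (w \<otimes> v)) \<otimes> b" using associator_eq[OF z w v] by (simp add: S_def b_def)
  \<comment> \<open>Moving \<open>a'\<close> to the right turns it into \<open>a\<close> past
    \<open>S\<close> and into \<open>conjugate v a\<close> past \<open>v\<close>.\<close>
  have "a' \<otimes> (S \<otimes> v) = (S \<otimes> a) \<otimes> v" using a' S v by (simp add: nuc_left)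
  also have "\<dots> = S \<otimes> (a \<otimes> v)" using a S v by (simp add: nuc_mid)
  also have "\<dots> = S \<otimes> (v \<otimes> conjugate v a)" using mult_conjugate[OF v, of a] a by simp
  also have "\<dots> = (S \<otimes> v) \<otimes> conjugate v a" using a S v by (simp add: nuc_right)
  also have "\<dots> = (z \<otimes> (w \<otimes> v)) \<otimes> (b \<otimes> conjugate v a)"
    using Sv a b z w v by (simp add: nuc_right)
  finally have aS: "a' \<otimes> (S \<otimes> v) = (z \<otimes> (w \<otimes> v)) \<otimes> (b \<otimes> conjugate v a)" .
  have "S \<otimes> (u \<otimes> v) = (e \<otimes> a') \<otimes> (S \<otimes> v)" using lcc[OF Su S u v] e a' by simp
  also have "\<dots> = e \<otimes> ((z \<otimes> (w \<otimes> v)) \<otimes> (b \<otimes> conjugate v a))"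
    using aS nuc_mid[OF a'(1) e(1), of "S \<otimes> v"] S v by simp
  also have "\<dots> = (e \<otimes> (z \<otimes> (w \<otimes> v))) \<otimes> (b \<otimes> conjugate v a)"
    using nuc_right[of "b \<otimes> conjugate v a"] a b e z w v by simp
  also have "e \<otimes> (z \<otimes> (w \<otimes> v)) = z \<otimes> (w \<otimes> (u \<otimes> v))" using eL v by simp
  finally have "associator z w (u \<otimes> v) = b \<otimes> conjugate v a"
    using a b z w u v by (intro associator_eqI) (simp_all add: S_def)
  then show ?thesis by (simp add: a_def b_def)
qed

lemma associator_nuclear:
  assumes "n \<in> nucleus" "x \<in> carrier Q" "y \<in> carrier Q"
  shows "associator n x y = \<one>"
  using assms by (simp add: associator_one_iff nuc_left)

section \<open>Conjugation as an action on the nucleus\<close>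

lemma conjugate_mult:
  assumes a: "a \<in> nucleus" and x: "x \<in> carrier Q" and y: "y \<in> carrier Q"
  shows "conjugate (x \<otimes> y) a = conjugate y (conjugate x a)"
proof (rule conjugate_eqI)
  have "a \<otimes> (x \<otimes> y) = (x \<otimes> conjugate x a) \<otimes> y"
    using a x y mult_conjugate[of x a] by (simp add: nuc_left)
  also have "\<dots> = x \<otimes> (conjugate x a \<otimes> y)" using a x y by (simp add: nuc_mid)
  also have "\<dots> = x \<otimes> (y \<otimes> conjugate y (conjugate x a))" using mult_conjugate[OF y, of "conjugate x a"] a x by simp
  also have "\<dots> = (x \<otimes> y) \<otimes> conjugate y (conjugate x a)" using a x y by (simp add: nuc_right)
  finally show "a \<otimes> (x \<otimes> y) = (x \<otimes> y) \<otimes> conjugate y (conjugate x a)" .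
qed (use a x y in simp_all)

lemma conjugate_nucleus_mult:
  assumes a: "a \<in> nucleus" and b: "b \<in> nucleus" and x: "x \<in> carrier Q"
  shows "conjugate x (a \<otimes> b) = conjugate x a \<otimes> conjugate x b"
proof (rule conjugate_eqI)
  have "(a \<otimes> b) \<otimes> x = a \<otimes> (x \<otimes> conjugate x b)"
    using a b x mult_conjugate[of x b] by (simp flip: nuc_left)
  also have "\<dots> = (x \<otimes> conjugate x a) \<otimes> conjugate x b"
    using a b x mult_conjugate[of x a] by (simp add: nuc_left)
  also have "\<dots> = x \<otimes> (conjugate x a \<otimes> conjugate x b)" using a b x by (simp add: nuc_right)
  finally show "(a \<otimes> b) \<otimes> x = x \<otimes> (conjugate x a \<otimes> conjugate x b)" .
qed (use a b x in simp_all)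

text \<open>Associators are central in the nucleus, so nuclear elements act trivially on them, and
  the conjugation action on them factors through the abelian quotient.\<close>

lemma conjugate_associator_eqv:
  assumes "eqv v' v" and v: "v \<in> carrier Q" and x: "x \<in> carrier Q" "y \<in> carrier Q" "z \<in> carrier Q"
  shows "conjugate v' (associator x y z) = conjugate v (associator x y z)"
proof -
  obtain n where n: "n \<in> nucleus" "v' = n \<otimes> v" using assms(1) by (rule eqvE)
  have "conjugate n (associator x y z) = associator x y z"
    using associator_central[OF x n(1)] x n by (intro conjugate_eqI) simp_all
  then show ?thesis using conjugate_mult[of "associator x y z" n v] n v x by simp
qed

section \<open>WIP elements and their squares\<close>

lemma WIP_associator:
  assumes "WIP_elem Q c" and c: "c \<in> carrier Q" and x: "x \<in> carrier Q"
  shows "associator x c (x \<otimes> c) = \<one>"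
proof -
  define u where "u = ldiv Q (x \<otimes> c) \<one>"
  have u: "u \<in> carrier Q" "(x \<otimes> c) \<otimes> u = \<one>" using x c by (auto simp: u_def)
  have "c \<otimes> u = ldiv Q x \<one>" using assms by (simp add: WIP_elem_def u_def)
  then have "x \<otimes> (c \<otimes> u) = \<one>" using x by simp
  then have 1: "associator x c u = \<one>" using u x c by (simp add: associator_one_iff)
  have "associator x c \<one> = \<one>" using x c by (simp add: associator_one_iff)
  then have "conjugate u (associator x c (x \<otimes> c)) = \<one>"
    using associator_mult[of x c "x \<otimes> c" u] u 1 x c by simp
  then show ?thesis using conjugate_eq_one u x c by simp
qed

text \<open>Polarisation of \<open>associator x c (xc) = 1\<close>: replace \<open>x\<close> by \<open>xy\<close> and expand.\<close>

lemma WIP_square_nuclear: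
  assumes wip: "WIP_elem Q c" and c: "c \<in> carrier Q"
  shows "c \<otimes> c \<in> nucleus"
proof (rule nucleusI_right)
  fix x y assume x: "x \<in> carrier Q" and y: "y \<in> carrier Q"
  define s where "s = associator x c y"
  define W where "W = (x \<otimes> y) \<otimes> c"
  have s: "s \<in> nucleus" and W: "W \<in> carrier Q" using x y c by (simp_all add: s_def W_def)
  have s': "s = associator y c x" using associator_swap_outer x y c by (simp add: s_def)
  have "eqv W (x \<otimes> (y \<otimes> c))" using eqv_assoc x y c by (simp add: W_def)
  then have "associator y c W = associator y c (x \<otimes> (y \<otimes> c))" using associator_eqv3 x y c by simp
  also have "\<dots> = conjugate (y \<otimes> c) s"
    using associator_mult[of y c x "y \<otimes> c"] WIP_associator[OF wip c y] s x y c by (simp add: s')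
  \<comment> \<open>The order is exchanged so that conjugation by \<open>y\<close> comes last and
    can be factored out of the final product.\<close>
  also have "\<dots> = conjugate (c \<otimes> y) s"
    unfolding s_def using conjugate_associator_eqv[OF eqv_comm] x y c by simp
  finally have yW: "associator y c W = conjugate y (conjugate c s)"
    using conjugate_mult s y c by simp
  have "eqv W (c \<otimes> (x \<otimes> y))" using eqv_comm x y c by (simp add: W_def)
  also have "eqv \<dots> ((c \<otimes> x) \<otimes> y)" using eqv_sym[OF eqv_assoc] x y c by simp
  also have "eqv \<dots> ((x \<otimes> c) \<otimes> y)" using eqv_mult_right[OF eqv_comm] x y c by simp
  finally have "eqv W ((x \<otimes> c) \<otimes> y)" .
  then have "associator x c W = associator x c ((x \<otimes> c) \<otimes> y)" using associator_eqv3 x y c by simp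
  then have xW: "associator x c W = s"
    using associator_mult[of x c "x \<otimes> c" y] WIP_associator[OF wip c x] x y c by (simp add: s_def)
  \<comment> \<open>The WIP relation for \<open>x y\<close>, expanded in its last argument
    \<open>x y\<close>, becomes the conjugate by \<open>y\<close> of
    \<open>conjugate c s \<otimes> s\<close>.\<close>
  have "\<one> = associator W c (x \<otimes> y)"
    using WIP_associator[OF wip c, of "x \<otimes> y"] associator_swap_outer[of "x \<otimes> y" c W] x y c W
    by (simp add: W_def)
  also have "\<dots> = conjugate y (conjugate c s) \<otimes> conjugate y s"
    using associator_mult[of W c x y] associator_swap_outer[of W c] yW xW W x y c by simp
  also have "\<dots> = conjugate y (conjugate c s \<otimes> s)"
    using conjugate_nucleus_mult s y c by simp
  finally have "conjugate c s \<otimes> s = \<one>" using conjugate_eq_one[of y] s y c by simp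
  then have "s \<otimes> conjugate c s = \<one>"
    using associator_central[OF x c y, of "conjugate c s"] s c by (simp add: s_def)
  moreover have "s = associator x y c" using associator_swap_right x y c by (simp add: s_def)
  \<comment> \<open>Expansion gives \<open>[x,y,c c] = s \<otimes> conjugate c s\<close>, which has
    just been shown to be trivial.\<close>
  ultimately have "associator x y (c \<otimes> c) = \<one>" using associator_mult[of x y c c] x y c by simp
  then show "x \<otimes> (y \<otimes> (c \<otimes> c)) = (x \<otimes> y) \<otimes> (c \<otimes> c)"
    using x y c by (simp add: associator_one_iff)
qed (use c in simp)

section \<open>Associating subloops and the generated group\<close>

text \<open>By symmetry the product formula also holds in the first argument. If two of the
  associators for \<open>u\<close>, \<open>v\<close>, \<open>u v\<close> are trivial, so is the
  third, because conjugation is injective and fixes \<open>1\<close>; this covers products and both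
  divisions.\<close>

lemma subloop_associating:
  assumes Y: "Y \<subseteq> carrier Q" and Z: "Z \<subseteq> carrier Q"
  shows "subloop {x \<in> carrier Q. \<forall>y\<in>Y. \<forall>z\<in>Z. associator x y z = \<one>} Q" (is "subloop ?H Q")
proof -
  have mult: "associator (u \<otimes> v) y z = associator v y z \<otimes> conjugate v (associator u y z)"
    if "u \<in> carrier Q" "v \<in> carrier Q" "y \<in> Y" "z \<in> Z" for u v y z
  proof -
    have "y \<in> carrier Q" "z \<in> carrier Q" using that Y Z by auto
    then show ?thesis
      using associator_mult[of z y u v] associator_swap_outer[of z y] that by simp
  qed
  have closed: "x \<otimes> y \<in> ?H \<and> ldiv Q x y \<in> ?H \<and> rdiv Q y x \<in> ?H" if "x \<in> ?H" "y \<in> ?H" for x y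
  proof (intro conjI)
    show "x \<otimes> y \<in> ?H" using mult that by simp
  next
    show "ldiv Q x y \<in> ?H"
    proof (clarsimp, intro conjI ballI)
      show "ldiv Q x y \<in> carrier Q" using that by simp
      fix b c assume bc: "b \<in> Y" "c \<in> Z"
      then have "b \<in> carrier Q" "c \<in> carrier Q" using Y Z by auto
      then show "associator (ldiv Q x y) b c = \<one>"
        using mult[of x "ldiv Q x y" b c] that bc by simp
    qed
  next
    show "rdiv Q y x \<in> ?H"
    proof (clarsimp, intro conjI ballI)
      show "rdiv Q y x \<in> carrier Q" using that by simp
      fix b c assume bc: "b \<in> Y" "c \<in> Z"
      then have bc': "b \<in> carrier Q" "c \<in> carrier Q" using Y Z by auto
      then have "conjugate x (associator (rdiv Q y x) b c) = \<one>"
        using mult[of "rdiv Q y x" x b c] that bc by simp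
      then show "associator (rdiv Q y x) b c = \<one>"
        using conjugate_eq_one that bc' by simp
    qed
  qed
  have "associator \<one> y z = \<one>" if "y \<in> Y" "z \<in> Z" for y z
    using associator_nuclear[OF one_nucleus] that Y Z by blast
  then have one: "\<one> \<in> ?H" using one_closed by blast
  show ?thesis
    unfolding subloop_def
  proof (intro conjI ballI)
    show "?H \<subseteq> carrier Q" by (rule Collect_restrict)
  qed (use one closed in simp_all)
qed

lemma subloop_carrier: "subloop (carrier Q) Q"
  by (simp add: subloop_def)

lemma subloop_generated_subset:
  "\<lbrakk>subloop H Q; S \<subseteq> H\<rbrakk> \<Longrightarrow> subloop_generated Q S \<subseteq> H"
  by (auto simp: subloop_generated_def)

lemma generators_subset: "S \<subseteq> subloop_generated Q S"
  by (auto simp: subloop_generated_def)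

lemma subloop_subloop_generated:
  assumes "S \<subseteq> carrier Q"
  shows "subloop (subloop_generated Q S) Q"
proof -
  have "subloop_generated Q S \<subseteq> carrier Q"
    using subloop_generated_subset[OF subloop_carrier assms] .
  then show ?thesis
    unfolding subloop_def by (auto simp: subloop_generated_def subloop_def)
qed

lemma group_subloop:
  assumes H: "subloop H Q" and assoc: "\<And>x y z. \<lbrakk>x \<in> H; y \<in> H; z \<in> H\<rbrakk> \<Longrightarrow> associator x y z = \<one>"
  shows "group (Q\<lparr>carrier := H\<rparr>)"
proof (rule groupI)
  have sub: "x \<in> carrier Q" if "x \<in> H" for x using H that by (auto simp: subloop_def)
  fix x assume x: "x \<in> carrier (Q\<lparr>carrier := H\<rparr>)"
  then show "\<exists>y\<in>carrier (Q\<lparr>carrier := H\<rparr>). y \<otimes>\<^bsub>Q\<lparr>carrier := H\<rparr>\<^esub> x = \<one>\<^bsub>Q\<lparr>carrier := H\<rparr>\<^esub>"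
    using H sub by (auto simp: subloop_def intro!: bexI[of _ "rdiv Q \<one> x"])
  show "\<one>\<^bsub>Q\<lparr>carrier := H\<rparr>\<^esub> \<otimes>\<^bsub>Q\<lparr>carrier := H\<rparr>\<^esub> x = x" using sub x by simp
  fix y z assume "y \<in> carrier (Q\<lparr>carrier := H\<rparr>)" "z \<in> carrier (Q\<lparr>carrier := H\<rparr>)"
  then show "x \<otimes>\<^bsub>Q\<lparr>carrier := H\<rparr>\<^esub> y \<otimes>\<^bsub>Q\<lparr>carrier := H\<rparr>\<^esub> z
      = x \<otimes>\<^bsub>Q\<lparr>carrier := H\<rparr>\<^esub> (y \<otimes>\<^bsub>Q\<lparr>carrier := H\<rparr>\<^esub> z)"
    using assoc[of x y z] associator_one_iff sub x by simp
qed (use H in \<open>auto simp: subloop_def\<close>)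

lemma group_generated:
  assumes b: "b \<in> carrier Q" and pa: "power_associative_elem Q b" and n: "n \<in> nucleus"
  shows "group (Q\<lparr>carrier := subloop_generated Q {b, n}\<rparr>)"
proof -
  define H where "H = subloop_generated Q {b, n}"
  have H: "subloop H Q" using subloop_subloop_generated b n by (simp add: H_def)
  have HQ: "H \<subseteq> carrier Q" using H by (simp add: subloop_def)
  interpret B: group "Q\<lparr>carrier := subloop_generated Q {b}\<rparr>"
    using pa by (simp add: power_associative_elem_def)
  have bbb: "associator b b b = \<one>"
    using B.m_assoc[of b b b] generators_subset[of "{b}"] b by (simp add: associator_one_iff)
  \<comment> \<open>One argument is extended from the generators to \<open>H\<close>. The generator
    \<open>n\<close> associates with everything, which leaves a condition on
    \<open>b\<close>.\<close>
  have gen: "associator x y z = \<one>"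
    if "Y \<subseteq> carrier Q" "Z \<subseteq> carrier Q" "\<And>y z. \<lbrakk>y \<in> Y; z \<in> Z\<rbrakk> \<Longrightarrow> associator b y z = \<one>"
      "x \<in> H" "y \<in> Y" "z \<in> Z" for x y z Y Z
  proof -
    let ?K = "{x \<in> carrier Q. \<forall>y\<in>Y. \<forall>z\<in>Z. associator x y z = \<one>}"
    have "associator n y z = \<one>" if "y \<in> Y" "z \<in> Z" for y z
      using associator_nuclear[OF n] that \<open>Y \<subseteq> carrier Q\<close> \<open>Z \<subseteq> carrier Q\<close> by blast
    then have "n \<in> ?K" using n by simp
    moreover have "b \<in> ?K" using that(3) b by simp
    ultimately have "H \<subseteq> ?K"
      unfolding H_def by (intro subloop_generated_subset subloop_associating that(1,2)) simp
    then show ?thesis using that(4-6) by blast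
  qed
  \<comment> \<open>Starting from \<open>[b,b,b] = 1\<close>, \<open>gen\<close> is applied with
    \<open>(Y, Z)\<close> equal to \<open>({b}, {b})\<close>, \<open>(H, {b})\<close> and
    \<open>(H, H)\<close>; symmetry brings each previous result into the form required for the
    next.\<close>
  have 1: "associator x b b = \<one>" if "x \<in> H" for x
    using gen[of "{b}" "{b}" x b b] bbb b that by simp
  have 2: "associator x y b = \<one>" if x: "x \<in> H" and y: "y \<in> H" for x y
  proof (rule gen[OF HQ _ _ x y singletonI])
    fix y z assume "y \<in> H" "z \<in> {b}"
    then show "associator b y z = \<one>" using associator_swap_left[OF b _ b, of y] 1 HQ by auto
  qed (use b in simp)
  have 3: "associator x y z = \<one>" if xyz: "x \<in> H" "y \<in> H" "z \<in> H" for x y z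
  proof (rule gen[OF HQ HQ _ xyz])
    fix y z assume yz: "y \<in> H" "z \<in> H"
    then show "associator b y z = \<one>" using associator_swap_outer[OF b, of y z] 2[OF yz(2,1)] HQ by auto
  qed
  show ?thesis using group_subloop[OF H 3] by (simp add: H_def)
qed

end

theorem theorem6p8:
  fixes Q :: "('a, 'b) monoid_scheme" (structure)
  assumes "cc_loop Q"
    and "b \<in> carrier Q" and "c \<in> carrier Q"
    and "power_associative_elem Q b" and "power_associative_elem Q c"
    and "WIP_elem Q c"
  shows "group (Q\<lparr>carrier := subloop_generated Q {b, c \<otimes> c}\<rparr>)"
proof -
  interpret cc_loop Q by fact
  show ?thesis using group_generated WIP_square_nuclear assms by blast
qed

end
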